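(* For all integers $k,p \geq 2$ and every integer $n \geq 2^{k^{10p}}$, the book $B_{k,n}$ is $p$-good; that is, $$r(K_p,B_{k,n}) = (p-1)(n-1)+1.$$
   Context: All graphs are finite and simple. For graphs $G,H$, the Ramsey number $r(G,H)$ is the smallest $N$ such that every graph $\Gamma$ on $N$ vertices contains $G$ as a (not necessarily induced) subgraph or its complement $\overline{\Gamma}$ contains $H$ as a (not necessarily induced) subgraph. For integers $n \geq k \geq 1$, the $k$-book $B_{k,n}$ is the graph on $n$ vertices consisting of a copy of $K_k$ (the spine) together with $n-k$ additional vertices, each adjacent to every vertex of the spine and pairwise non-adjacent. A connected graph $H$ on $n$ vertices is called $p$-good if $r(K_p,H)=(p-1)(n-1)+1$. *)

theory Defs
  imports
    "Graph_Theory.Pair_Digraph"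
    "Graph_Theory.Digraph_Component"
    "Graph_Theory.Digraph_Isomorphism"
    "Graph_Theory.Kuratowski"
    "HOL-Library.Ramsey"
begin

text \<open>
  A finite simple graph is a \<^locale>\<open>pair_graph\<close>: a finite loop-free digraph with a symmetric set of
  arcs, each arc being the pair of its ends.
\<close>

definition complement_graph :: "'a pair_pre_digraph \<Rightarrow> 'a pair_pre_digraph" where
  "complement_graph G =
    \<lparr>pverts = pverts G,
     parcs = {(u, v). u \<in> pverts G \<and> v \<in> pverts G \<and> u \<noteq> v \<and> (u, v) \<notin> parcs G}\<rparr>"

definition contains_copy :: "'b pair_pre_digraph \<Rightarrow> 'a pair_pre_digraph \<Rightarrow> bool" where
  "contains_copy \<Gamma> G \<longleftrightarrow>
    (\<exists>G' :: 'b pair_pre_digraph. subgraph (with_proj G') (with_proj \<Gamma>) \<and>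
      digraph_iso (with_proj G) (with_proj G'))"

text \<open>
  Vertex sets of \<open>\<Gamma>\<close> are taken in \<^typ>\<open>nat\<close>, which loses no isomorphism type of finite graphs.
  By Ramsey's theorem the minimum is over a nonempty set for all finite simple \<open>G\<close>, \<open>H\<close>.
\<close>

definition ramsey_number :: "'a pair_pre_digraph \<Rightarrow> 'b pair_pre_digraph \<Rightarrow> nat" where
  "ramsey_number G H =
    (LEAST N. \<forall>\<Gamma> :: nat pair_pre_digraph. pair_graph \<Gamma> \<and> card (pverts \<Gamma>) = N \<longrightarrow>
      contains_copy \<Gamma> G \<or> contains_copy (complement_graph \<Gamma>) H)"

definition complete_graph :: "nat \<Rightarrow> nat pair_pre_digraph" where
  "complete_graph n = \<lparr>pverts = {..<n}, parcs = {(u, v). u < n \<and> v < n \<and> u \<noteq> v}\<rparr>"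

text \<open>
  The \<open>k\<close>-book on \<open>n\<close> vertices; its spine is \<open>{..<k}\<close>. Only meaningful for \<open>1 \<le> k \<le> n\<close>.
\<close>

definition book_graph :: "nat \<Rightarrow> nat \<Rightarrow> nat pair_pre_digraph" where
  "book_graph k n =
    \<lparr>pverts = {..<n}, parcs = {(u, v). u < n \<and> v < n \<and> u \<noteq> v \<and> (u < k \<or> v < k)}\<rparr>"

definition ramsey_good :: "nat \<Rightarrow> 'a pair_pre_digraph \<Rightarrow> bool" where
  "ramsey_good p H \<longleftrightarrow>
    pair_graph H \<and> connected (with_proj H) \<and>
    ramsey_number (complete_graph p) H = (p - 1) * (card (pverts H) - 1) + 1"

lemma complete_digraph_complete_graph: "K\<^bsub>n\<^esub> (with_proj (complete_graph n))"
  by (auto simp: complete_digraph_pair_def complete_graph_def)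

lemma pair_graph_complete_graph: "pair_graph (complete_graph n)"
  by (rule pair_graphI_complete[OF complete_digraph_complete_graph])

lemma pair_graph_book_graph: "pair_graph (book_graph k n)"
proof -
  have "finite (parcs (book_graph k n))"
    by (rule finite_subset[of _ "{..<n} \<times> {..<n}"]) (auto simp: book_graph_def)
  then show ?thesis
    by unfold_locales (auto simp: book_graph_def symmetric_def intro: symI)
qed

lemma card_book_graph: "card (pverts (book_graph k n)) = n"
  by (simp add: book_graph_def)

lemma pair_graph_complement_graph:
  assumes "pair_graph G"
  shows "pair_graph (complement_graph G)"
proof -
  interpret pair_graph G by fact
  have "finite (parcs (complement_graph G))"
    by (rule finite_subset[of _ "pverts G \<times> pverts G"])
      (auto simp: complement_graph_def pair_finite_verts)
  moreover have "(u, v) \<in> parcs G \<longleftrightarrow> (v, u) \<in> parcs G" for u v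
    using pair_sym_arcs by (auto simp: symmetric_def dest: symD)
  ultimately show ?thesis
    by unfold_locales
      (auto simp: complement_graph_def symmetric_def pair_finite_verts intro: symI)
qed

lemma contains_copy_iff:
  assumes "pair_graph G" "pair_graph \<Gamma>"
  shows "contains_copy \<Gamma> G \<longleftrightarrow>
    (\<exists>f. inj_on f (pverts G) \<and> f ` pverts G \<subseteq> pverts \<Gamma> \<and>
      (\<forall>u v. (u, v) \<in> parcs G \<longrightarrow> (f u, f v) \<in> parcs \<Gamma>))"
    (is "_ \<longleftrightarrow> (\<exists>f. ?emb f)")
proof
  interpret G: pair_graph G by fact
  assume "contains_copy \<Gamma> G"
  then obtain G' :: "'b pair_pre_digraph" and h
    where sub: "subgraph (with_proj G') (with_proj \<Gamma>)"
      and h: "pre_digraph.digraph_isomorphism (with_proj G) h"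
      and G': "with_proj G' = app_iso h (with_proj G)"
    by (auto simp: contains_copy_def digraph_iso_def)
  have proj: "iso_tail h = fst" "iso_head h = snd"
    using arg_cong[OF G', of tail] arg_cong[OF G', of head] by (simp_all add: app_iso_def)
  have V: "pverts G' = iso_verts h ` pverts G" and A: "parcs G' = iso_arcs h ` parcs G"
    using arg_cong[OF G', of verts] arg_cong[OF G', of arcs] by simp_all
  have arc: "iso_arcs h (u, v) = (iso_verts h u, iso_verts h v)" if "(u, v) \<in> parcs G" for u v
    using h that by (auto simp: pre_digraph.digraph_isomorphism_def proj prod_eq_iff)
  have "(iso_verts h u, iso_verts h v) \<in> parcs \<Gamma>" if "(u, v) \<in> parcs G" for u v
    using sub A arc[OF that] that by (force simp: subgraph_def)
  moreover have "inj_on (iso_verts h) (pverts G)"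
    using h by (simp add: pre_digraph.digraph_isomorphism_def)
  moreover have "iso_verts h ` pverts G \<subseteq> pverts \<Gamma>"
    using sub V by (simp add: subgraph_def)
  ultimately show "\<exists>f. ?emb f" by blast
next
  interpret G: pair_graph G by fact
  interpret \<Gamma>: pair_graph \<Gamma> by fact
  assume "\<exists>f. ?emb f"
  then obtain f where f: "inj_on f (pverts G)" "f ` pverts G \<subseteq> pverts \<Gamma>"
    and arcs: "\<And>u v. (u, v) \<in> parcs G \<Longrightarrow> (f u, f v) \<in> parcs \<Gamma>"
    by blast
  define h where "h = \<lparr>iso_verts = f, iso_arcs = map_prod f f, iso_head = snd, iso_tail = fst\<rparr>"
  define G' where "G' = \<lparr>pverts = f ` pverts G, parcs = map_prod f f ` parcs G\<rparr>"
  have sub: "parcs G \<subseteq> pverts G \<times> pverts G"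
    using G.in_arcsD1 G.in_arcsD2 by auto
  have "pre_digraph.digraph_isomorphism (with_proj G) h"
    using f(1) G.wf_digraph inj_on_subset[OF map_prod_inj_on[OF f(1) f(1)] sub]
    by (simp add: h_def pre_digraph.digraph_isomorphism_def)
  moreover have "with_proj G' = app_iso h (with_proj G)"
    by (simp add: G'_def h_def app_iso_def with_proj_def)
  moreover have "wf_digraph (with_proj G')"
    by unfold_locales (use sub in \<open>auto simp: G'_def\<close>)
  then have "subgraph (with_proj G') (with_proj \<Gamma>)"
    using f(2) arcs \<Gamma>.wf_digraph by (auto simp: subgraph_def G'_def)
  ultimately show "contains_copy \<Gamma> G"
    unfolding contains_copy_def digraph_iso_def by blast
qed

lemma connected_book_graph:
  assumes "1 \<le> k" "k \<le> n"
  shows "connected (with_proj (book_graph k n))"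
proof -
  interpret pair_graph "book_graph k n" by (rule pair_graph_book_graph)
  have 0: "u \<rightarrow>\<^sup>*\<^bsub>with_proj (book_graph k n)\<^esub> 0" "0 \<rightarrow>\<^sup>*\<^bsub>with_proj (book_graph k n)\<^esub> u" if "u < n" for u
  proof -
    have "u = 0 \<or> (u, 0) \<in> parcs (book_graph k n) \<and> (0, u) \<in> parcs (book_graph k n)"
      using that assms by (auto simp: book_graph_def)
    moreover have "u \<in> pverts (book_graph k n)" using that by (simp add: book_graph_def)
    ultimately show "u \<rightarrow>\<^sup>*\<^bsub>with_proj (book_graph k n)\<^esub> 0" "0 \<rightarrow>\<^sup>*\<^bsub>with_proj (book_graph k n)\<^esub> u"
      by auto
  qed
  have "strongly_connected (with_proj (book_graph k n))"
  proof (rule strongly_connectedI)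
    show "verts (with_proj (book_graph k n)) \<noteq> {}"
      using assms by (auto simp: book_graph_def lessThan_empty_iff)
    show "u \<rightarrow>\<^sup>*\<^bsub>with_proj (book_graph k n)\<^esub> v"
      if "u \<in> verts (with_proj (book_graph k n))" "v \<in> verts (with_proj (book_graph k n))" for u v
    proof (rule reachable_trans)
      show "u \<rightarrow>\<^sup>*\<^bsub>with_proj (book_graph k n)\<^esub> 0" "0 \<rightarrow>\<^sup>*\<^bsub>with_proj (book_graph k n)\<^esub> v"
        using 0 that by (auto simp: book_graph_def)
    qed
  qed
  moreover have "mk_symmetric (with_proj (book_graph k n)) = book_graph k n"
    by (auto simp: mk_symmetric_def book_graph_def)
  ultimately show ?thesis by (simp add: connected_def)
qed

lemma ramsey_number_attained:
  fixes G :: "'a pair_pre_digraph" and H :: "'b pair_pre_digraph"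
  assumes G: "pair_graph G" and H: "pair_graph H"
  assumes \<Gamma>: "pair_graph (\<Gamma> :: nat pair_pre_digraph)" "card (pverts \<Gamma>) = ramsey_number G H"
  shows "contains_copy \<Gamma> G \<or> contains_copy (complement_graph \<Gamma>) H"
proof -
  interpret G: pair_graph G by fact
  interpret H: pair_graph H by fact
  obtain r where r: "\<And>V :: nat set. \<And>E. finite V \<Longrightarrow> card V \<ge> r \<Longrightarrow>
      \<exists>R \<subseteq> V. card R = card (pverts G) \<and> clique R E \<or> card R = card (pverts H) \<and> indep R E"
    using ramsey2[where ?'a = nat, of "card (pverts G)" "card (pverts H)"] by metis
  have "contains_copy \<Delta> G \<or> contains_copy (complement_graph \<Delta>) H"
    if \<Delta>: "pair_graph \<Delta>" "card (pverts \<Delta>) = r" for \<Delta> :: "nat pair_pre_digraph"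
  proof -
    interpret \<Delta>: pair_graph \<Delta> by fact
    define E where "E = {{u, v} | u v. (u, v) \<in> parcs \<Delta>}"
    have "(u, v) \<in> parcs \<Delta> \<longleftrightarrow> (v, u) \<in> parcs \<Delta>" for u v
      using \<Delta>.pair_sym_arcs by (auto simp: symmetric_def dest: symD)
    then have E: "{u, v} \<in> E \<longleftrightarrow> (u, v) \<in> parcs \<Delta>" for u v
      unfolding E_def mem_Collect_eq doubleton_eq_iff by blast
    obtain R where "R \<subseteq> pverts \<Delta>" and R: "card R = card (pverts G) \<and> clique R E \<or>
        card R = card (pverts H) \<and> indep R E"
      using r[OF \<Delta>.pair_finite_verts eq_refl[OF \<Delta>(2)[symmetric]], of E] by (elim exE conjE)
    then have "finite R" using \<Delta>.pair_finite_verts finite_subset by blast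
    from R show ?thesis
    proof
      assume R: "card R = card (pverts G) \<and> clique R E"
      then obtain f where f: "bij_betw f (pverts G) R"
        using finite_same_card_bij[OF G.pair_finite_verts \<open>finite R\<close>] by auto
      have "(f u, f v) \<in> parcs \<Delta>" if "(u, v) \<in> parcs G" for u v
      proof -
        have "u \<in> pverts G" "v \<in> pverts G" "u \<noteq> v"
          using G.in_arcsD1[OF that] G.in_arcsD2[OF that] G.pair_no_loops[OF that] by simp_all
        then have "f u \<in> R" "f v \<in> R" "f u \<noteq> f v"
          using f by (auto simp: bij_betw_def inj_on_def)
        then show ?thesis using R by (auto simp: clique_def E)
      qed
      then have "contains_copy \<Delta> G"
        using f \<open>R \<subseteq> pverts \<Delta>\<close> by (auto simp: contains_copy_iff[OF G \<Delta>(1)] bij_betw_def)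
      then show ?thesis ..
    next
      assume R: "card R = card (pverts H) \<and> indep R E"
      then obtain f where f: "bij_betw f (pverts H) R"
        using finite_same_card_bij[OF H.pair_finite_verts \<open>finite R\<close>] by auto
      have "(f u, f v) \<in> parcs (complement_graph \<Delta>)" if "(u, v) \<in> parcs H" for u v
      proof -
        have "u \<in> pverts H" "v \<in> pverts H" "u \<noteq> v"
          using H.in_arcsD1[OF that] H.in_arcsD2[OF that] H.pair_no_loops[OF that] by simp_all
        then have "f u \<in> R" "f v \<in> R" "f u \<noteq> f v"
          using f by (auto simp: bij_betw_def inj_on_def)
        then show ?thesis
          using R \<open>R \<subseteq> pverts \<Delta>\<close> by (auto simp: indep_def E complement_graph_def)
      qed
      moreover have "pverts (complement_graph \<Delta>) = pverts \<Delta>"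
        by (simp add: complement_graph_def)
      ultimately have "contains_copy (complement_graph \<Delta>) H"
        using f \<open>R \<subseteq> pverts \<Delta>\<close>
        by (auto simp: contains_copy_iff[OF H pair_graph_complement_graph[OF \<Delta>(1)]] bij_betw_def)
      then show ?thesis ..
    qed
  qed
  then have "\<forall>\<Delta> :: nat pair_pre_digraph. pair_graph \<Delta> \<and> card (pverts \<Delta>) = r \<longrightarrow>
      contains_copy \<Delta> G \<or> contains_copy (complement_graph \<Delta>) H"
    by simp
  then have "\<forall>\<Delta> :: nat pair_pre_digraph. pair_graph \<Delta> \<and> card (pverts \<Delta>) = ramsey_number G H \<longrightarrow>
      contains_copy \<Delta> G \<or> contains_copy (complement_graph \<Delta>) H"
    unfolding ramsey_number_def by (rule LeastI)
  from this[THEN spec, THEN mp, OF conjI[OF \<Gamma>]] show ?thesis .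
qed

end

theory Submission
  imports Defs "HOL-Library.Disjoint_Sets"
begin

text \<open>
  The lower bound comes from a complete \<open>(p - 1)\<close>-partite graph with parts of size at most
  \<open>n - 1\<close>: it has no \<open>p\<close>-clique, and the components of its complement are too small for a book.

  For the upper bound, write \<open>P = p - 1\<close> and \<open>d = n - 1\<close>, and let \<open>\<Gamma>\<close> be a graph without \<open>p\<close>-clique
  on a set \<open>V\<close> of \<open>P * d + 1\<close> vertices. For an independent \<open>k\<close>-set \<open>I\<close>, let \<open>W\<close> be the set of vertices that
  have no neighbour in \<open>I\<close>; it contains \<open>I\<close>. If \<open>W\<close> has more than \<open>d\<close> elements, the complement
  contains the book with spine \<open>I\<close> and pages in \<open>W\<close>. So it suffices to find such an \<open>I\<close>.

  Suppose that independent \<open>k\<close>-sets \<open>A 0, \<dots>, A (P - 1)\<close> are completely joined to each other. A vertex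
  with a neighbour in each of them would complete a transversal to a \<open>p\<close>-clique, so every vertex of
  \<open>V\<close> misses some \<open>A i\<close> entirely, and by pigeonhole one of the \<open>P\<close> sets \<open>A i\<close> is missed by more than
  \<open>d\<close> vertices. Everything thus reduces to finding an induced complete \<open>P\<close>-partite subgraph with
  parts of size \<open>k\<close>.

  This subgraph is built one part at a time, starting from much larger parts
  (\<open>extend_multipartite\<close>). Assume that every independent \<open>k\<close>-set is missed by at most \<open>d\<close> vertices,
  and let there be \<open>r < P\<close> parts, each of which is cut into \<open>q\<close> blocks of size \<open>k\<close>. A vertex with few
  neighbours in a part misses most of its blocks, so by double counting
  (\<open>few_vertices_with_few_neighbours\<close>) at most \<open>2 * P * d / (P + r)\<close> vertices are poor for a given
  part. Since \<open>r < P\<close>, at least \<open>d / 2\<close> vertices remain that have many neighbours in every part.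
  By pigeonhole, a large class of these has the same neighbours in the union of the parts; within
  this class Ramsey's theorem gives an independent set, which becomes the new part, and the other
  parts shrink to sets of common neighbours of the class. The parts shrink at each step by a factor of order \<open>k * P / (P - r)\<close>. The
  product of these factors is exponential in \<open>P\<close> rather than of order \<open>P ^ P\<close>, since
  \<open>P ^ P / fact P \<le> exp P\<close>; this is what keeps all parts below \<open>k * (8 * k) ^ P\<close> and the
  number of possible neighbourhoods below \<open>2 ^ (k ^ (10 * p))\<close>.
\<close>

section \<open>A Ramsey bound, equal blocks and large fibres\<close>

text \<open>
  This is the Erdos--Szekeres argument: of the two sets of neighbours and non-neighbours of a vertex, one has
  at least \<open>2 ^ (a + b - 1)\<close> elements, while \<open>a + b\<close> drops by one.
\<close>
lemma clique_or_indep_pow2: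
  assumes "finite V" "2 ^ (a + b) \<le> card V"
  shows "\<exists>R \<subseteq> V. card R = a \<and> clique R E \<or> card R = b \<and> indep R E"
  using assms
proof (induction "a + b" arbitrary: a b V)
  case 0
  then show ?case by (auto intro: exI[of _ "{}"])
next
  case (Suc c)
  show ?case
  proof (cases "a = 0 \<or> b = 0")
    case True
    then show ?thesis by (auto intro!: exI[of _ "{}"])
  next
    case False
    then obtain a' b' where ab: "a = Suc a'" "b = Suc b'" by (metis not0_implies_Suc)
    have "card V \<noteq> 0" using Suc.prems(2) by (metis not_le power_eq_0_iff zero_less_iff_neq_zero zero_neq_numeral)
    then obtain v where v: "v \<in> V" by (metis card.empty ex_in_conv)
    define Y where "Y = {x \<in> V - {v}. {v, x} \<in> E}"
    define Z where "Z = {x \<in> V - {v}. {v, x} \<notin> E}"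
    have fin: "finite Y" "finite Z" using Suc.prems(1) by (auto simp: Y_def Z_def)
    have "card Y + card Z = card (Y \<union> Z)"
      using fin by (subst card_Un_disjoint) (auto simp: Y_def Z_def)
    also have "Y \<union> Z = V - {v}" by (auto simp: Y_def Z_def)
    finally have "card Y + card Z + 1 = card V"
      using card.remove[OF Suc.prems(1) v] by simp
    moreover have "card V \<ge> 2 * 2 ^ c" using Suc by (metis power_Suc)
    ultimately consider "2 ^ c \<le> card Y" | "2 ^ c \<le> card Z" by linarith
    then show ?thesis
    proof cases
      case 1
      then have "\<exists>R \<subseteq> Y. card R = a' \<and> clique R E \<or> card R = b \<and> indep R E"
        using Suc.hyps(1)[of a' b Y] Suc.hyps(2) fin ab by simp
      then obtain R where R: "R \<subseteq> Y" "card R = a' \<and> clique R E \<or> card R = b \<and> indep R E" by blast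
      have "R \<subseteq> V" "v \<notin> R" "finite R"
        using R(1) fin by (auto simp: Y_def intro: finite_subset)
      moreover have "clique (insert v R) E" if "clique R E"
        using that R(1) by (auto simp: clique_def Y_def insert_commute)
      ultimately show ?thesis
        using R(2) v ab by (metis card_insert_disjoint insert_subset)
    next
      case 2
      then have "\<exists>R \<subseteq> Z. card R = a \<and> clique R E \<or> card R = b' \<and> indep R E"
        using Suc.hyps(1)[of a b' Z] Suc.hyps(2) fin ab by simp
      then obtain R where R: "R \<subseteq> Z" "card R = a \<and> clique R E \<or> card R = b' \<and> indep R E" by blast
      have "R \<subseteq> V" "v \<notin> R" "finite R"
        using R(1) fin by (auto simp: Z_def intro: finite_subset)
      moreover have "indep (insert v R) E" if "indep R E"
        using that R(1) by (auto simp: indep_def Z_def insert_commute)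
      ultimately show ?thesis
        using R(2) v ab by (metis card_insert_disjoint insert_subset)
    qed
  qed
qed

lemma equal_blocks:
  assumes "finite A" "card A = k * q"
  obtains P where "\<And>b. b < q \<Longrightarrow> P b \<subseteq> A" "\<And>b. b < q \<Longrightarrow> card (P b) = k"
    "disjoint_family_on P {..<q}"
proof -
  obtain f where f: "bij_betw f {..<k * q} A"
    using ex_bij_betw_nat_finite[OF assms(1)] assms(2) by (auto simp: atLeast0LessThan)
  define P where "P b = f ` {k * b..<k * b + k}" for b
  have sub: "{k * b..<k * b + k} \<subseteq> {..<k * q}" if "b < q" for b
  proof -
    have "k * b + k \<le> k * q" using that by (metis Suc_leI mult_Suc_right add.commute mult_le_mono2)
    then show ?thesis by auto
  qed
  show thesis
  proof (rule that[of P])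
    show "P b \<subseteq> A" if "b < q" for b
      using sub[OF that] f by (auto simp: P_def bij_betw_def)
    show "card (P b) = k" if "b < q" for b
      using card_image[OF inj_on_subset[OF bij_betw_imp_inj_on[OF f] sub[OF that]]]
      by (simp add: P_def)
    have "b \<le> c" if bc: "b < q" "c < q" "x \<in> P b" "x \<in> P c" for b c x
    proof (rule ccontr)
      assume "\<not> b \<le> c"
      obtain i j where i: "i \<in> {k * b..<k * b + k}" "x = f i"
        and j: "j \<in> {k * c..<k * c + k}" "x = f j"
        using bc by (auto simp: P_def)
      have "i = j"
        using i j sub[OF that(1)] sub[OF that(2)] bij_betw_imp_inj_on[OF f]
        by (metis inj_onD subsetD)
      moreover have "k * c + k \<le> k * b"
        using \<open>\<not> b \<le> c\<close> by (metis Suc_leI mult_Suc_right add.commute mult_le_mono2 not_le)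
      ultimately show False using i j by simp
    qed
    then have "b = c" if "b < q" "c < q" "x \<in> P b" "x \<in> P c" for b c x
      using that by (meson antisym)
    then show "disjoint_family_on P {..<q}"
      unfolding disjoint_family_on_def by blast
  qed
qed

lemma large_fibre:
  assumes "finite U" "\<And>x. x \<in> X \<Longrightarrow> f x \<subseteq> U" "finite X"
  obtains T where "card X \<le> 2 ^ card U * card {x \<in> X. f x = T}"
proof -
  have "card X \<le> (\<Sum>T \<in> Pow U. card {x \<in> X. f x = T})"
  proof -
    have "X \<subseteq> (\<Union>T \<in> Pow U. {x \<in> X. f x = T})" using assms by blast
    then have "card X \<le> card (\<Union>T \<in> Pow U. {x \<in> X. f x = T})"
      using assms by (intro card_mono) auto
    also have "\<dots> \<le> (\<Sum>T \<in> Pow U. card {x \<in> X. f x = T})"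
      using assms by (intro card_UN_le) auto
    finally show ?thesis .
  qed
  define m where "m = Max ((\<lambda>T. card {x \<in> X. f x = T}) ` Pow U)"
  have fin: "finite ((\<lambda>T. card {x \<in> X. f x = T}) ` Pow U)" using assms by simp
  note \<open>card X \<le> _\<close>
  also have "(\<Sum>T \<in> Pow U. card {x \<in> X. f x = T}) \<le> (\<Sum>T \<in> Pow U. m)"
    unfolding m_def by (intro sum_mono Max_ge[OF fin]) auto
  also have "\<dots> = 2 ^ card U * m" using assms by (simp add: card_Pow)
  finally have "card X \<le> 2 ^ card U * m" .
  moreover have "m \<in> (\<lambda>T. card {x \<in> X. f x = T}) ` Pow U"
    unfolding m_def using fin by (intro Max_in) auto
  then obtain T where "m = card {x \<in> X. f x = T}" by auto
  ultimately show thesis using that[of T] by simp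
qed

section \<open>Vertices with few neighbours in an independent set\<close>

text \<open>
  An independent set \<open>I\<close> inside \<open>V\<close> is contained in \<open>nonneighbours V E I\<close> when there are no loops; that set then
  consists of all vertices of the largest book with spine \<open>I\<close> in the complement, spine included.
\<close>
definition nonneighbours :: "'a set \<Rightarrow> 'a set set \<Rightarrow> 'a set \<Rightarrow> 'a set" where
  "nonneighbours V E I = {x \<in> V. \<forall>a \<in> I. {a, x} \<notin> E}"

definition neighbours_in :: "'a set set \<Rightarrow> 'a set \<Rightarrow> 'a \<Rightarrow> 'a set" where
  "neighbours_in E A x = {a \<in> A. {a, x} \<in> E}"

text \<open>
  The set \<open>A\<close> is cut into \<open>q\<close> blocks of size \<open>k\<close>. A vertex with fewer than \<open>s\<close> neighbours in \<open>A\<close> meets at most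
  \<open>s - 1\<close> blocks, so it misses at least \<open>q + 1 - s\<close> of them, whereas each block is missed by at most \<open>d\<close> vertices.
  Counting the missing pairs in both ways gives the bound.
\<close>
lemma few_vertices_with_few_neighbours:
  assumes V: "finite V" "A \<subseteq> V" and A: "indep A E" "card A = k * q"
    and small: "\<And>I. I \<subseteq> V \<Longrightarrow> card I = k \<Longrightarrow> indep I E \<Longrightarrow> card (nonneighbours V E I) \<le> d"
  shows "card {x \<in> V. card (neighbours_in E A x) < s} * (q + 1 - s) \<le> q * d"
proof -
  define L where "L = {x \<in> V. card (neighbours_in E A x) < s}"
  have fin: "finite A" using V finite_subset by blast
  obtain P where P: "\<And>b. b < q \<Longrightarrow> P b \<subseteq> A" "\<And>b. b < q \<Longrightarrow> card (P b) = k"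
    and disj: "disjoint_family_on P {..<q}"
    using equal_blocks[OF fin A(2)] by metis
  \<comment> \<open>Distinct blocks that \<open>x\<close> meets contribute distinct neighbours of \<open>x\<close>, since the blocks are disjoint.\<close>
  have miss: "q + 1 - s \<le> card {b \<in> {..<q}. x \<in> nonneighbours V E (P b)}" if "x \<in> L" for x
  proof -
    define H where "H = {b \<in> {..<q}. x \<notin> nonneighbours V E (P b)}"
    have "\<forall>b \<in> H. \<exists>a. a \<in> P b \<and> {a, x} \<in> E"
      using that by (auto simp: H_def nonneighbours_def L_def)
    then obtain g where g: "\<And>b. b \<in> H \<Longrightarrow> g b \<in> P b" "\<And>b. b \<in> H \<Longrightarrow> {g b, x} \<in> E"
      by metis
    have "b = c" if "b \<in> H" "c \<in> H" "g b = g c" for b c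
      using disj g(1)[OF that(1)] g(1)[OF that(2)] that
      by (auto simp: disjoint_family_on_def H_def)
    then have "inj_on g H" by (simp add: inj_on_def)
    moreover have "g ` H \<subseteq> neighbours_in E A x"
      using g P(1) by (fastforce simp: neighbours_in_def H_def)
    moreover have "finite (neighbours_in E A x)" using fin by (simp add: neighbours_in_def)
    ultimately have "card H \<le> card (neighbours_in E A x)" by (metis card_inj_on_le)
    also have "\<dots> < s" using that by (simp add: L_def)
    finally have "card H < s" .
    moreover have "card ({..<q} - H) = q - card H"
      by (subst card_Diff_subset) (auto simp: H_def)
    moreover have "{..<q} - H = {b \<in> {..<q}. x \<in> nonneighbours V E (P b)}"
      by (auto simp: H_def)
    ultimately show ?thesis by simp
  qed
  have "card L * (q + 1 - s) = (\<Sum>x\<in>L. q + 1 - s)" by simp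
  also have "\<dots> \<le> (\<Sum>x\<in>L. card {b \<in> {..<q}. x \<in> nonneighbours V E (P b)})"
    by (rule sum_mono) (rule miss)
  also have "\<dots> = (\<Sum>b<q. card {x \<in> L. x \<in> nonneighbours V E (P b)})"
    using V(1) by (intro sum_multicount_gen) (auto simp: L_def)
  also have "\<dots> \<le> (\<Sum>b<q. d)"
  proof (rule sum_mono)
    fix b assume "b \<in> {..<q}"
    then have b: "b < q" by simp
    have "card {x \<in> L. x \<in> nonneighbours V E (P b)} \<le> card (nonneighbours V E (P b))"
      using V(1) by (intro card_mono) (auto simp: nonneighbours_def)
    also have "\<dots> \<le> d"
      using P[OF b] V(2) smaller_indep[OF A(1)] by (intro small) auto
    finally show "card {x \<in> L. x \<in> nonneighbours V E (P b)} \<le> d" .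
  qed
  finally show ?thesis by (simp add: L_def)
qed

section \<open>Growing an induced complete multipartite subgraph\<close>

text \<open>The parts are disjoint as soon as \<open>E\<close> has no loops.\<close>
definition induced_multipartite :: "'a set set \<Rightarrow> nat \<Rightarrow> nat \<Rightarrow> (nat \<Rightarrow> 'a set) \<Rightarrow> bool" where
  "induced_multipartite E r m A \<longleftrightarrow>
    (\<forall>i<r. card (A i) = m \<and> indep (A i) E) \<and>
    (\<forall>i<r. \<forall>j<r. i \<noteq> j \<longrightarrow> (\<forall>a \<in> A i. \<forall>b \<in> A j. {a, b} \<in> E))"

text \<open>
  The vertices that are poor for some part number at most \<open>2 * P * d * r / (P + r)\<close>, which falls short of
  \<open>card V\<close> by at least \<open>d / 2\<close> since \<open>r < P\<close>. The remaining vertices are sorted by their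
  neighbourhood in the union of the parts, and a large class yields the new part. The hypothesis
  \<open>2 * P * s \<le> (P - r) * q\<close> fixes the trade-off: a smaller proportion \<open>s / q\<close> makes poor
  vertices rarer, but shrinks the parts faster.
\<close>
lemma extend_multipartite:
  fixes V :: "'a set"
  assumes V: "finite V" "card V = P * d + 1"
    and no_clique: "\<And>C. C \<subseteq> V \<Longrightarrow> clique C E \<Longrightarrow> card C \<noteq> p"
    and small: "\<And>I. I \<subseteq> V \<Longrightarrow> card I = k \<Longrightarrow> indep I E \<Longrightarrow> card (nonneighbours V E I) \<le> d"
    and A: "induced_multipartite E r (k * q) A" "\<And>i. i < r \<Longrightarrow> A i \<subseteq> V"
    and r: "r < P" and s: "2 * P * s \<le> (P - r) * q"
    and d: "2 ^ (p + s + r * (k * q) + 1) \<le> d + 1"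
  obtains B where "induced_multipartite E (Suc r) s B" "\<And>i. i \<le> r \<Longrightarrow> B i \<subseteq> V"
proof (cases "s = 0")
  case True
  then show thesis by (intro that[of "\<lambda>_. {}"]) (auto simp: induced_multipartite_def)
next
  case False
  define poor where "poor i = {x \<in> V. card (neighbours_in E (A i) x) < s}" for i
  define good where "good = V - (\<Union>i<r. poor i)"
  have "q > 0" using s False r by (cases q) auto
  have poor: "card (poor i) * (P + r) \<le> 2 * P * d" if "i < r" for i
  proof -
    have "card (poor i) * (q + 1 - s) \<le> q * d"
      using A that unfolding poor_def
      by (intro few_vertices_with_few_neighbours[OF V(1) _ _ _ small])
        (auto simp: induced_multipartite_def)
    then have "card (poor i) * (q + 1 - s) * (2 * P) \<le> q * d * (2 * P)" by (rule mult_le_mono1)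
    moreover have "q * (P + r) \<le> (q + 1 - s) * (2 * P)"
    proof -
      have "int (q * (P + r)) \<le> (int q + 1 - int s) * (2 * int P)"
      proof -
        have "2 * int P * int s \<le> (int P - int r) * int q"
          using s r by (metis of_nat_mult of_nat_le_iff of_nat_diff less_imp_le of_nat_numeral)
        then show ?thesis by (simp add: algebra_simps)
      qed
      moreover have "(int q + 1 - int s) * (2 * int P) \<le> int ((q + 1 - s) * (2 * P))"
        unfolding of_nat_mult of_nat_numeral by (intro mult_right_mono) auto
      ultimately show ?thesis by linarith
    qed
    then have "card (poor i) * (q * (P + r)) \<le> card (poor i) * ((q + 1 - s) * (2 * P))"
      by (rule mult_le_mono2)
    ultimately have "q * (card (poor i) * (P + r)) \<le> q * (2 * P * d)"
      by (simp add: algebra_simps)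
    then show ?thesis using \<open>q > 0\<close> by simp
  qed
  have good: "d + 1 \<le> 2 * card good"
  proof -
    define b where "b = card (\<Union>i<r. poor i)"
    have "b \<le> (\<Sum>i<r. card (poor i))" unfolding b_def by (rule card_UN_le) simp
    then have "b * (P + r) \<le> (\<Sum>i<r. card (poor i) * (P + r))"
      by (metis mult_le_mono1 sum_distrib_right)
    also have "\<dots> \<le> (\<Sum>i<r. 2 * P * d)" using poor by (intro sum_mono) auto
    finally have b: "b * (P + r) \<le> 2 * P * d * r" by (simp add: mult.commute)
    have "card good = card V - b"
      unfolding good_def b_def using V(1)
      by (intro card_Diff_subset) (auto simp: poor_def intro: finite_subset)
    moreover have "b \<le> card V" unfolding b_def using V(1) by (intro card_mono) (auto simp: poor_def)
    ultimately have g: "int (card good) = int P * int d + 1 - int b" using V(2) by simp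
    have "int b * (int P + int r) \<le> 2 * int P * int d * int r"
      using b by (metis of_nat_le_iff of_nat_mult of_nat_add of_nat_numeral)
    moreover have "(int P - int r) * (2 * int P * int d) \<ge> 1 * ((int P + int r) * int d)"
      using r by (intro mult_mono) (auto intro!: mult_right_mono)
    ultimately have "(int P + int r) * (int d + 1) \<le> (int P + int r) * (2 * int (card good))"
      unfolding g using r by (simp add: algebra_simps)
    then have "int d + 1 \<le> 2 * int (card good)" using r by simp
    then show ?thesis by linarith
  qed
  \<comment> \<open>A class \<open>X\<close> of good vertices that agree on all the parts together.\<close>
  define U where "U = (\<Union>i<r. A i)"
  have "finite U" "U \<subseteq> V" using A V(1) by (auto simp: U_def intro: finite_subset)
  have U: "card U \<le> r * (k * q)"
  proof -
    have "card U \<le> (\<Sum>i<r. card (A i))" unfolding U_def by (rule card_UN_le) simp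
    also have "\<dots> = r * (k * q)" using A by (simp add: induced_multipartite_def)
    finally show ?thesis .
  qed
  have "finite good" using V(1) by (simp add: good_def)
  then obtain T where T: "card good \<le> 2 ^ card U * card {x \<in> good. neighbours_in E U x = T}"
    using large_fibre[of U good "neighbours_in E U"] \<open>finite U\<close> by (auto simp: neighbours_in_def)
  define X where "X = {x \<in> good. neighbours_in E U x = T}"
  have X: "X \<subseteq> V" "finite X" using V(1) by (auto simp: X_def good_def)
  have "2 * 2 ^ (r * (k * q)) * 2 ^ (p + s) \<le> d + 1"
    using d by (simp add: power_add mult_ac)
  also have "\<dots> \<le> 2 * (2 ^ card U * card X)" using good T by (simp add: X_def)
  also have "\<dots> \<le> 2 * (2 ^ (r * (k * q)) * card X)"
    using U by (intro mult_le_mono le_refl power_increasing) auto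
  finally have "2 ^ (p + s) \<le> card X" by simp
  then obtain R where R: "R \<subseteq> X" "card R = s" "indep R E"
    using clique_or_indep_pow2[OF X(2)] no_clique X(1) by (metis subset_trans)
  have "R \<noteq> {}" using R(2) False by auto
  then obtain x0 where x0: "x0 \<in> X" using R(1) by auto
  have "\<exists>C. C \<subseteq> A i \<inter> T \<and> card C = s" if "i < r" for i
  proof -
    have "A i \<inter> T = neighbours_in E (A i) x0"
      using x0 that by (auto simp: X_def neighbours_in_def U_def)
    moreover have "s \<le> card (neighbours_in E (A i) x0)"
      using x0 that by (force simp: X_def good_def poor_def)
    ultimately show ?thesis by (metis obtain_subset_with_card_n)
  qed
  then obtain C where C: "\<And>i. i < r \<Longrightarrow> C i \<subseteq> A i \<inter> T" "\<And>i. i < r \<Longrightarrow> card (C i) = s"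
    by metis
  have CR: "{a, x} \<in> E" if "i < r" "a \<in> C i" "x \<in> R" for i a x
  proof -
    have "a \<in> neighbours_in E U x" using that C(1)[of i] R(1) by (auto simp: X_def)
    then show ?thesis by (simp add: neighbours_in_def)
  qed
  define B where "B = C(r := R)"
  show thesis
  proof (rule that[of B])
    show "B i \<subseteq> V" if "i \<le> r" for i
      using that C(1)[of i] A(2)[of i] R(1) X(1) by (cases "i = r") (auto simp: B_def)
    have "card (B i) = s \<and> indep (B i) E" if "i < Suc r" for i
    proof (cases "i = r")
      case False
      then have "i < r" using that by simp
      then show ?thesis
        using C[of i] A(1) False by (auto simp: B_def induced_multipartite_def intro: smaller_indep)
    qed (use R in \<open>simp add: B_def\<close>)
    moreover have "{a, b} \<in> E" if ij: "i < Suc r" "j < Suc r" "i \<noteq> j" "a \<in> B i" "b \<in> B j" for i j a b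
    proof -
      consider "i < r" "j = r" | "i = r" "j < r" | "i < r" "j < r" using ij by linarith
      then show ?thesis
      proof cases
        case 1
        then show ?thesis using CR[of i a b] 1 that by (auto simp: B_def)
      next
        case 2
        then show ?thesis using CR[of j b a] 2 that by (auto simp: B_def insert_commute)
      next
        case 3
        then have "a \<in> A i" "b \<in> A j" using that C(1)[of i] C(1)[of j] by (auto simp: B_def)
        then show ?thesis using A(1) 3 ij(3) unfolding induced_multipartite_def by blast
      qed
    qed
    ultimately show "induced_multipartite E (Suc r) s B"
      unfolding induced_multipartite_def by blast
  qed
qed

lemma transversal_clique:
  assumes loopless: "\<And>v. {v} \<notin> E"
    and A: "induced_multipartite E r m A" "\<And>i. i < r \<Longrightarrow> A i \<subseteq> V"
    and x: "x \<in> V" "\<And>i. i < r \<Longrightarrow> x \<notin> nonneighbours V E (A i)"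
  obtains C where "C \<subseteq> V" "card C = Suc r" "clique C E"
proof -
  have "\<exists>a. a \<in> A i \<and> {a, x} \<in> E" if "i < r" for i
    using x(1) x(2)[OF that] by (auto simp: nonneighbours_def)
  then obtain g where g: "\<And>i. i < r \<Longrightarrow> g i \<in> A i" "\<And>i. i < r \<Longrightarrow> {g i, x} \<in> E"
    by metis
  have edge: "{g i, g j} \<in> E" if "i < r" "j < r" "i \<noteq> j" for i j
    using A(1) g(1)[OF that(1)] g(1)[OF that(2)] that by (simp add: induced_multipartite_def)
  have "inj_on g {..<r}"
    using edge loopless by (metis inj_onI insert_absorb2 lessThan_iff)
  moreover have "x \<notin> g ` {..<r}" using g(2) loopless by (metis imageE insert_absorb2 lessThan_iff)
  ultimately have "card (insert x (g ` {..<r})) = Suc r" by (simp add: card_image)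
  moreover have "clique (insert x (g ` {..<r})) E"
    using g(2) edge by (auto simp: clique_def insert_commute)
  moreover have "insert x (g ` {..<r}) \<subseteq> V" using x(1) g(1) A(2) by auto
  ultimately show thesis using that by blast
qed

section \<open>The sizes of the parts\<close>

text \<open>
  When \<open>j\<close> parts are still to be added, each part consists of \<open>blocks_at k P j\<close> blocks of size \<open>k\<close>.
  Shrinking requires successive ratios of at least \<open>2 * k * P / j\<close>. The binomial coefficients have the ratios
  \<open>(P + j - 1) / j \<ge> P / j\<close>, so they provide an integral sequence that grows no faster than
  exponentially in \<open>P\<close>. The value at \<open>j = 0\<close> is \<open>1\<close>, hence the construction ends with parts of size \<open>k\<close>.
\<close>
definition blocks_at :: "nat \<Rightarrow> nat \<Rightarrow> nat \<Rightarrow> nat" where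
  "blocks_at k P j = (2 * k) ^ j * (P + j - 1 choose j)"

lemma blocks_at_step:
  assumes "r < P"
  shows "2 * P * (k * blocks_at k P (P - Suc r)) \<le> (P - r) * blocks_at k P (P - r)"
proof -
  \<comment> \<open>The absorption identity for binomial coefficients gives the ratio of consecutive values.\<close>
  define j where "j = P - Suc r"
  have j: "P - r = Suc j" using assms by (simp add: j_def)
  obtain P' where P': "P = Suc P'" using assms by (cases P) auto
  have "P * (P + j - 1 choose j) \<le> (P + j) * (P + j - 1 choose j)" by simp
  also have "\<dots> = Suc j * (P + j choose Suc j)"
    using Suc_times_binomial_eq[of "P' + j" j] by (simp add: P')
  finally have "(2 * k) ^ Suc j * (P * (P + j - 1 choose j)) \<le> (2 * k) ^ Suc j * (Suc j * (P + j choose Suc j))"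
    by (rule mult_le_mono2)
  then show ?thesis
    unfolding j j_def[symmetric] blocks_at_def power_Suc by (simp add: mult_ac del: mult_Suc mult_Suc_right)
qed

lemma blocks_at_le:
  assumes "j \<le> P" "1 \<le> k"
  shows "blocks_at k P j \<le> (8 * k) ^ P"
proof -
  have "(P + j - 1 choose j) \<le> 2 ^ (P + j - 1)" by (rule binomial_le_pow2)
  also have "\<dots> \<le> (2::nat) ^ (2 * P)" using assms by (intro power_increasing) auto
  also have "\<dots> = 4 ^ P" by (simp add: power_mult)
  finally have "(P + j - 1 choose j) \<le> 4 ^ P" .
  moreover have "(2 * k) ^ j \<le> (2 * k) ^ P" using assms by (intro power_increasing) auto
  ultimately have "blocks_at k P j \<le> (2 * k) ^ P * 4 ^ P"
    unfolding blocks_at_def by (intro mult_le_mono) auto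
  also have "\<dots> = (2 * k * 4) ^ P" by (rule power_mult_distrib[symmetric])
  also have "2 * k * 4 = 8 * k" by simp
  finally show ?thesis .
qed

text \<open>
  The left-hand side is the exponent in the size hypothesis of \<open>extend_multipartite\<close>, with \<open>m\<close> and \<open>s\<close> the
  sizes of the old and the new parts. It is at most \<open>P + 1\<close> times the bound on \<open>m\<close> and \<open>s\<close>, and the
  factor \<open>P + 1 \<le> 2 ^ P\<close> is absorbed by powers of \<open>k\<close> because \<open>16 \<le> k ^ 4\<close>.
\<close>
lemma exponent_bound:
  assumes k: "2 \<le> k" and P: "1 \<le> P" "r < P"
    and m: "m \<le> k * (8 * k) ^ P" "s \<le> k * (8 * k) ^ P"
  shows "Suc P + s + r * m + 1 \<le> k ^ (10 * Suc P)"
proof -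
  define M where "M = k * (8 * k) ^ P"
  have "2 ^ P * (8 * k) ^ P = (2 * (8 * k)) ^ P" by (rule power_mult_distrib[symmetric])
  also have "2 * (8 * k) = 16 * k" by simp
  finally have M2: "2 ^ P * M = k * (16 * k) ^ P" by (simp only: M_def mult.left_commute)
  have "P + 2 \<le> 2 * 2 ^ P" using less_exp[of P] P(1) by linarith
  also have "\<dots> \<le> k * (8 * k) ^ P" using k by (intro mult_le_mono power_mono) auto
  finally have "Suc P + 1 \<le> M" by (simp add: M_def)
  moreover have "r * m \<le> (P - 1) * M" using P m by (intro mult_le_mono) (auto simp: M_def)
  ultimately have "Suc P + s + r * m + 1 \<le> M + M + (P - 1) * M" using m(2) by (simp add: M_def)
  also have "\<dots> = Suc P * M" using P by (cases P) auto
  also have "\<dots> \<le> 2 ^ P * M"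
    using P by (intro mult_le_mono1) (simp add: Suc_leI)
  also note M2
  also have "k * (16 * k) ^ P \<le> k * (k ^ 5) ^ P"
  proof -
    have "(2::nat) ^ 4 \<le> k ^ 4" using k by (rule power_mono) simp
    then have "16 * k \<le> k ^ 4 * k" by simp
    also have "k ^ 4 * k = k ^ 5" using power_add[of k 4 1] by simp
    finally have "16 * k \<le> k ^ 5" .
    then show ?thesis by (intro mult_le_mono2 power_mono) auto
  qed
  also have "\<dots> = k ^ (5 * P + 1)" by (simp add: power_mult)
  also have "\<dots> \<le> k ^ (10 * Suc P)" using k by (intro power_increasing) auto
  finally show ?thesis .
qed

section \<open>A clique or a large common non-neighbourhood\<close>

text \<open>
  The induction on \<open>r\<close> starts with no parts at all. Its first step finds one large independent set in \<open>V\<close>,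
  and after \<open>P\<close> steps the parts have shrunk to size \<open>k\<close>. As no vertex
  has neighbours in all \<open>P\<close> parts, the \<open>P\<close> sets of non-neighbours cover the \<open>P * d + 1\<close> vertices, which contradicts that
  each has at most \<open>d\<close> elements.
\<close>
lemma clique_or_large_nonneighbourhood:
  fixes V :: "'a set"
  assumes V: "finite V" "card V = P * d + 1" and loopless: "\<And>v. {v} \<notin> E"
    and k: "2 \<le> k" and P: "1 \<le> P" and d: "2 ^ (k ^ (10 * Suc P)) \<le> d + 1"
  shows "(\<exists>C \<subseteq> V. card C = Suc P \<and> clique C E) \<or>
    (\<exists>I \<subseteq> V. card I = k \<and> indep I E \<and> d < card (nonneighbours V E I))"
proof (rule ccontr)
  assume contra: "\<not> ?thesis"
  then have no_clique: "\<And>C. C \<subseteq> V \<Longrightarrow> clique C E \<Longrightarrow> card C \<noteq> Suc P"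
    by blast
  from contra have small: "\<And>I. I \<subseteq> V \<Longrightarrow> card I = k \<Longrightarrow> indep I E \<Longrightarrow> card (nonneighbours V E I) \<le> d"
    by (blast intro: leI)
  have "\<exists>A. induced_multipartite E r (k * blocks_at k P (P - r)) A \<and> (\<forall>i<r. A i \<subseteq> V)" if "r \<le> P" for r
    using that
  proof (induction r)
    case 0
    then show ?case by (simp add: induced_multipartite_def)
  next
    case (Suc r)
    then have r: "r < P" by simp
    obtain A where A: "induced_multipartite E r (k * blocks_at k P (P - r)) A" "\<And>i. i < r \<Longrightarrow> A i \<subseteq> V"
      using Suc by auto
    have "Suc P + k * blocks_at k P (P - Suc r) + r * (k * blocks_at k P (P - r)) + 1 \<le> k ^ (10 * Suc P)"
      using k r P by (intro exponent_bound mult_le_mono2 blocks_at_le) auto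
    then have "2 ^ (Suc P + k * blocks_at k P (P - Suc r) + r * (k * blocks_at k P (P - r)) + 1)
        \<le> (2::nat) ^ (k ^ (10 * Suc P))"
      by (intro power_increasing) auto
    also note d
    finally obtain B where "induced_multipartite E (Suc r) (k * blocks_at k P (P - Suc r)) B"
      "\<And>i. i \<le> r \<Longrightarrow> B i \<subseteq> V"
      using extend_multipartite[OF V no_clique small A r blocks_at_step[OF r]] by blast
    then show ?case by (auto simp: less_Suc_eq_le)
  qed
  from this[of P] obtain A where A: "induced_multipartite E P k A" "\<And>i. i < P \<Longrightarrow> A i \<subseteq> V"
    by (auto simp: blocks_at_def)
  have "V \<subseteq> (\<Union>i<P. nonneighbours V E (A i))"
  proof
    fix x assume x: "x \<in> V"
    show "x \<in> (\<Union>i<P. nonneighbours V E (A i))"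
    proof (rule ccontr)
      assume "x \<notin> (\<Union>i<P. nonneighbours V E (A i))"
      then obtain C where "C \<subseteq> V" "card C = Suc P" "clique C E"
        using transversal_clique[OF loopless A x] by blast
      then show False using no_clique by blast
    qed
  qed
  then have "card V \<le> card (\<Union>i<P. nonneighbours V E (A i))"
    using V(1) by (intro card_mono) (auto simp: nonneighbours_def)
  also have "\<dots> \<le> (\<Sum>i<P. card (nonneighbours V E (A i)))" by (rule card_UN_le) simp
  also have "\<dots> \<le> (\<Sum>i<P. d)"
    using A by (intro sum_mono small) (auto simp: induced_multipartite_def)
  finally show False using V(2) by simp
qed

section \<open>The upper bound\<close>

lemma contains_complete_graphI:
  assumes \<Gamma>: "pair_graph \<Gamma>" and C: "C \<subseteq> pverts \<Gamma>" "card C = p"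
    and arcs: "\<And>u v. u \<in> C \<Longrightarrow> v \<in> C \<Longrightarrow> u \<noteq> v \<Longrightarrow> (u, v) \<in> parcs \<Gamma>"
  shows "contains_copy \<Gamma> (complete_graph p)"
proof -
  interpret pair_graph \<Gamma> by fact
  have "finite C" using C(1) pair_finite_verts finite_subset by blast
  then obtain f where f: "bij_betw f {..<p} C"
    using ex_bij_betw_nat_finite C(2) by (metis atLeast0LessThan)
  have "(f u, f v) \<in> parcs \<Gamma>" if "u < p" "v < p" "u \<noteq> v" for u v
    using f that by (intro arcs) (auto simp: bij_betw_def inj_on_def)
  then show ?thesis
    using f C unfolding contains_copy_iff[OF pair_graph_complete_graph \<Gamma>]
    by (auto simp: complete_graph_def bij_betw_def intro!: exI[of _ f])
qed

lemma contains_book_graphI: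
  assumes \<Gamma>: "pair_graph \<Gamma>" and W: "W \<subseteq> pverts \<Gamma>" "n \<le> card W"
    and I: "I \<subseteq> W" "card I = k" and kn: "k \<le> n"
    and arcs: "\<And>u v. u \<in> I \<Longrightarrow> v \<in> W \<Longrightarrow> u \<noteq> v \<Longrightarrow> (u, v) \<in> parcs \<Gamma>"
  shows "contains_copy \<Gamma> (book_graph k n)"
proof -
  interpret pair_graph \<Gamma> by fact
  have fin: "finite W" "finite I"
    using W(1) I(1) pair_finite_verts by (blast intro: finite_subset)+
  have "n - k \<le> card (W - I)" using W(2) I fin by (simp add: card_Diff_subset)
  then obtain J where J: "J \<subseteq> W - I" "card J = n - k" "finite J"
    by (metis obtain_subset_with_card_n)
  obtain f where f: "bij_betw f {..<k} I"
    using ex_bij_betw_nat_finite[OF fin(2)] I(2) by (metis atLeast0LessThan)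
  obtain g where g: "bij_betw g {k..<n} J"
    using finite_same_card_bij[of "{k..<n}" J] J by auto
  define h where "h i = (if i < k then f i else g i)" for i
  have hk: "h ` {..<k} = I" "inj_on h {..<k}"
    using f by (auto simp: h_def bij_betw_def inj_on_def)
  have hj: "h ` {k..<n} = J" "inj_on h {k..<n}"
    using g by (auto simp: h_def bij_betw_def inj_on_def)
  have split: "{..<n} = {..<k} \<union> {k..<n}" using kn by auto
  have inj: "inj_on h {..<n}"
    unfolding split using hk hj J by (subst inj_on_Un) auto
  have img: "h ` {..<n} \<subseteq> W" using hk hj J I unfolding split image_Un by auto
  have spine: "(h u, h v) \<in> parcs \<Gamma>" "(h v, h u) \<in> parcs \<Gamma>" if "u < k" "v < n" "u \<noteq> v" for u v
  proof -
    have "h u \<noteq> h v" using inj that kn by (auto simp: inj_on_def)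
    then show "(h u, h v) \<in> parcs \<Gamma>"
      using hk(1) img that by (intro arcs) auto
    then show "(h v, h u) \<in> parcs \<Gamma>"
      using pair_sym_arcs by (auto simp: symmetric_def dest: symD)
  qed
  have "(h u, h v) \<in> parcs \<Gamma>" if "(u, v) \<in> parcs (book_graph k n)" for u v
    using that spine by (auto simp: book_graph_def)
  moreover have "pverts (book_graph k n) = {..<n}" by (simp add: book_graph_def)
  ultimately show ?thesis
    using inj img W(1) unfolding contains_copy_iff[OF pair_graph_book_graph \<Gamma>] by (metis subset_trans)
qed

lemma clique_or_book:
  assumes \<Gamma>: "pair_graph \<Gamma>" "card (pverts \<Gamma>) = (p - 1) * (n - 1) + 1"
    and k: "2 \<le> k" and p: "2 \<le> p" and n: "2 ^ (k ^ (10 * p)) \<le> n" "k \<le> n"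
  shows "contains_copy \<Gamma> (complete_graph p) \<or>
    contains_copy (complement_graph \<Gamma>) (book_graph k n)"
proof -
  interpret pair_graph \<Gamma> by fact
  define E where "E = {{u, v} | u v. (u, v) \<in> parcs \<Gamma>}"
  have "(u, v) \<in> parcs \<Gamma> \<longleftrightarrow> (v, u) \<in> parcs \<Gamma>" for u v
    using pair_sym_arcs by (auto simp: symmetric_def dest: symD)
  then have E: "{u, v} \<in> E \<longleftrightarrow> (u, v) \<in> parcs \<Gamma>" for u v
    unfolding E_def mem_Collect_eq doubleton_eq_iff by blast
  have loopless: "{v} \<notin> E" for v
  proof
    assume "{v} \<in> E"
    then have "(v, v) \<in> parcs \<Gamma>" using E[of v v] by simp
    from pair_no_loops[OF this] show False by simp
  qed
  have "Suc (p - 1) = p" "1 \<le> p - 1" "n - 1 + 1 = n" using p k n by auto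
  then consider C where "C \<subseteq> pverts \<Gamma>" "card C = p" "clique C E"
    | I where "I \<subseteq> pverts \<Gamma>" "card I = k" "indep I E"
      "n - 1 < card (nonneighbours (pverts \<Gamma>) E I)"
    using clique_or_large_nonneighbourhood[OF pair_finite_verts \<Gamma>(2) loopless k] n(1)
    by metis
  then show ?thesis
  proof cases
    case 1
    then show ?thesis
      using contains_complete_graphI[OF \<Gamma>(1)] by (auto simp: clique_def E)
  next
    case 2
    have "contains_copy (complement_graph \<Gamma>) (book_graph k n)"
    proof (rule contains_book_graphI[OF pair_graph_complement_graph[OF \<Gamma>(1)] _ _ _ \<open>card I = k\<close> n(2)])
      show "n \<le> card (nonneighbours (pverts \<Gamma>) E I)" using 2(4) by simp
      show "nonneighbours (pverts \<Gamma>) E I \<subseteq> pverts (complement_graph \<Gamma>)"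
        by (auto simp: nonneighbours_def complement_graph_def)
      show "I \<subseteq> nonneighbours (pverts \<Gamma>) E I"
        using 2(1,3) loopless by (force simp: nonneighbours_def indep_def)
      show "(u, v) \<in> parcs (complement_graph \<Gamma>)"
        if "u \<in> I" "v \<in> nonneighbours (pverts \<Gamma>) E I" "u \<noteq> v" for u v
        using that 2(1) by (auto simp: nonneighbours_def complement_graph_def E)
    qed
    then show ?thesis ..
  qed
qed

section \<open>The lower bound\<close>

text \<open>
  The parts are intervals of length \<open>d\<close> (the last one may be shorter), so \<open>N \<le> P * d\<close> vertices occupy at most
  \<open>P\<close> parts.
\<close>
definition div_multipartite :: "nat \<Rightarrow> nat \<Rightarrow> nat pair_pre_digraph" where
  "div_multipartite d N =
    \<lparr>pverts = {..<N}, parcs = {(u, v). u < N \<and> v < N \<and> u div d \<noteq> v div d}\<rparr>"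

lemma pair_graph_div_multipartite: "pair_graph (div_multipartite d N)"
proof -
  have "finite (parcs (div_multipartite d N))"
    by (rule finite_subset[of _ "{..<N} \<times> {..<N}"]) (auto simp: div_multipartite_def)
  then show ?thesis
    by unfold_locales (auto simp: div_multipartite_def symmetric_def intro: symI)
qed

lemma div_multipartite_no_complete_graph:
  assumes "N \<le> P * d"
  shows "\<not> contains_copy (div_multipartite d N) (complete_graph (Suc P))"
proof
  assume "contains_copy (div_multipartite d N) (complete_graph (Suc P))"
  then obtain f where f: "f ` {..<Suc P} \<subseteq> {..<N}"
    and arcs: "\<And>u v. u < Suc P \<Longrightarrow> v < Suc P \<Longrightarrow> u \<noteq> v \<Longrightarrow> f u div d \<noteq> f v div d"
    unfolding contains_copy_iff[OF pair_graph_complete_graph pair_graph_div_multipartite]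
    by (auto simp: complete_graph_def div_multipartite_def)
  have "inj_on (\<lambda>u. f u div d) {..<Suc P}"
    using arcs by (auto simp: inj_on_def)
  moreover have "(\<lambda>u. f u div d) ` {..<Suc P} \<subseteq> {..<P}"
    using f assms by (force intro: less_mult_imp_div_less)
  ultimately have "card {..<Suc P} \<le> card {..<P}" by (rule card_inj_on_le) simp
  then show False by simp
qed

text \<open>
  The first vertex of the spine is adjacent to all other vertices of the book, so a copy of the book
  in the complement lies inside a single part.
\<close>
lemma complement_div_multipartite_no_book_graph:
  assumes "1 \<le> k" "0 < d"
  shows "\<not> contains_copy (complement_graph (div_multipartite d N)) (book_graph k (Suc d))"
proof
  assume "contains_copy (complement_graph (div_multipartite d N)) (book_graph k (Suc d))"
  then obtain f where inj: "inj_on f {..<Suc d}"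
    and arcs: "\<And>u v. (u, v) \<in> parcs (book_graph k (Suc d)) \<Longrightarrow>
      (f u, f v) \<in> parcs (complement_graph (div_multipartite d N))"
    unfolding contains_copy_iff[OF pair_graph_book_graph
        pair_graph_complement_graph[OF pair_graph_div_multipartite]]
    by (auto simp: book_graph_def)
  have same: "f v div d = f 0 div d" if "v < Suc d" for v
    using arcs[of 0 v] that assms
    by (cases "v = 0") (auto simp: book_graph_def complement_graph_def div_multipartite_def)
  have "f ` {..<Suc d} \<subseteq> {d * (f 0 div d)..<d * (f 0 div d) + d}"
  proof (rule image_subsetI)
    fix v assume "v \<in> {..<Suc d}"
    then have "f v div d = f 0 div d" using same lessThan_iff by blast
    then show "f v \<in> {d * (f 0 div d)..<d * (f 0 div d) + d}"
      using mult_div_mod_eq[of d "f v"] mod_less_divisor[OF assms(2), of "f v"] by simp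
  qed
  then have "card {..<Suc d} \<le> card {d * (f 0 div d)..<d * (f 0 div d) + d}"
    using inj by (intro card_inj_on_le) auto
  then show False by simp
qed

theorem theorem1p1:
  fixes k p n :: nat
  assumes "k \<ge> 2" and "p \<ge> 2" and "n \<ge> 2 ^ (k ^ (10 * p))"
  shows "ramsey_good p (book_graph k n) \<and>
    ramsey_number (complete_graph p) (book_graph k n) = (p - 1) * (n - 1) + 1"
proof -
  have kn: "k < n"
  proof -
    have "k ^ 1 \<le> k ^ (10 * p)" using assms by (intro power_increasing) auto
    also have "\<dots> < 2 ^ (k ^ (10 * p))" by (rule less_exp)
    finally show ?thesis using assms(3) by simp
  qed
  have p: "Suc (p - 1) = p" and n: "Suc (n - 1) = n" using assms kn by auto
  have "ramsey_number (complete_graph p) (book_graph k n) = (p - 1) * (n - 1) + 1"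
    unfolding ramsey_number_def
  proof (rule Least_equality, intro allI impI, elim conjE)
    fix \<Gamma> :: "nat pair_pre_digraph"
    assume "pair_graph \<Gamma>" "card (pverts \<Gamma>) = (p - 1) * (n - 1) + 1"
    then show "contains_copy \<Gamma> (complete_graph p) \<or>
        contains_copy (complement_graph \<Gamma>) (book_graph k n)"
      using assms kn by (intro clique_or_book) auto
  next
    fix N
    assume N: "\<forall>\<Gamma> :: nat pair_pre_digraph. pair_graph \<Gamma> \<and> card (pverts \<Gamma>) = N \<longrightarrow>
      contains_copy \<Gamma> (complete_graph p) \<or> contains_copy (complement_graph \<Gamma>) (book_graph k n)"
    show "(p - 1) * (n - 1) + 1 \<le> N"
    proof (rule ccontr)
      assume "\<not> (p - 1) * (n - 1) + 1 \<le> N"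
      then have "\<not> contains_copy (div_multipartite (n - 1) N) (complete_graph p)"
        using div_multipartite_no_complete_graph[of N "p - 1" "n - 1"] p by simp
      moreover have "\<not> contains_copy (complement_graph (div_multipartite (n - 1) N)) (book_graph k n)"
        using complement_div_multipartite_no_book_graph[of k "n - 1" N] n kn assms(1) by simp
      moreover have "card (pverts (div_multipartite (n - 1) N)) = N"
        by (simp add: div_multipartite_def)
      ultimately show False using N pair_graph_div_multipartite by blast
    qed
  qed
  then show ?thesis
    using connected_book_graph[of k n] kn assms(1)
    by (simp add: ramsey_good_def pair_graph_book_graph card_book_graph)
qed

end
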